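(* Let $\beta\in\mathbb{R}^p$, $D\subset\mathbb{R}^p$, let $\epsilon$ be a random vector in $\mathbb{R}^n$, let $G:\mathbb{R}^n\to\mathbb{R}$, and let $\varphi=(\varphi_1,\ldots,\varphi_n)$ and $\psi=(\psi_1,\ldots,\psi_n)$ with $\varphi_i,\psi_i:\mathbb{R}\to\mathbb{R}$. Let $q\in(0,1)$ and suppose there are nonrandom constants $c_1>0$, $c_2>0$ such that the following two conditions hold: (H1) $\Pr\{|\langle \epsilon,\varphi(Xu)-\varphi(X\beta)\rangle|\le c_1\sqrt{n}\,\|u-\beta\|_1 \text{ for all } u\in D\}\ge 1-2q$; (H2) for all $u\in D$, $G(\psi(Xu)-\psi(X\beta))\ge c_2\,n\,\|u-\beta\|_2^2$. If $\widehat\beta\in D$ is a random variable that always satisfies $$G(\psi(X\widehat\beta)-\psi(X\beta))\le 2|\langle\epsilon,\varphi(X\widehat\beta)-\varphi(X\beta)\rangle| - c_r\big(|\mathrm{spt}(\widehat\beta)|-|\mathrm{spt}(\beta)|\big)$$ with $c_r=3c_1^2/c_2$, then, letting $\kappa_r=3c_1/c_2$, $$\Pr\left\{\|\widehat\beta-\beta\|_2\le \frac{\kappa_r\sqrt{|\mathrm{spt}(\beta)|}}{\sqrt n}\right\}\ge 1-2q.$$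
   Context: $X$ is a fixed (nonrandom) real $n\times p$ matrix all of whose columns are nonzero. For $u\in\mathbb{R}^p$, $\mathrm{spt}(u)=\{i:u_i\ne 0\}$; $|A|$ is the cardinality of a set $A$; $\|\cdot\|_s$ is the $\ell_s$ norm. For $\varphi=(\varphi_1,\ldots,\varphi_n)$ and $x\in\mathbb{R}^n$, $\varphi(x)=(\varphi_1(x_1),\ldots,\varphi_n(x_n))^\top$, and similarly for $\psi$. *)

theory Defs
  imports "HOL-Probability.Probability"
begin

text \<open>The \<open>\<ell>\<^sub>2\<close> norm and the inner product on \<open>real ^ 'p\<close> are the library's
  \<^const>\<open>norm\<close> and \<^const>\<open>inner\<close>.\<close>

definition spt :: "real ^ 'p \<Rightarrow> 'p set" where
  "spt u = {i. u $ i \<noteq> 0}"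

definition l1_norm :: "real ^ 'p \<Rightarrow> real" where
  "l1_norm u = (\<Sum>i\<in>UNIV. \<bar>u $ i\<bar>)"

definition apply_coords :: "('n \<Rightarrow> real \<Rightarrow> real) \<Rightarrow> real ^ 'n \<Rightarrow> real ^ 'n" where
  "apply_coords f x = (\<chi> i. f i (x $ i))"

end

theory Submission
  imports Defs
begin

text \<open>On the event of (H1) the stochastic term is at most
  \<open>c\<^sub>1 \<surd>n \<surd>(s + b) \<delta>\<close>, where \<open>\<delta>\<close> is the \<open>\<ell>\<^sub>2\<close> error and \<open>s\<close>, \<open>b\<close> are the support sizes of
  the estimator and of \<open>\<beta>\<close>. Splitting twice this term by AM-GM with weight \<open>1/3\<close>, the penalty
  with constant \<open>3 c\<^sub>1\<^sup>2 / c\<^sub>2\<close> cancels \<open>s\<close> exactly, and what is left is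
  \<open>n \<delta>\<^sup>2 \<le> (3 c\<^sub>1 / c\<^sub>2)\<^sup>2 b\<close>.\<close>

lemma card_spt_diff_le:
  fixes u v :: "real ^ 'p"
  shows "card (spt (u - v)) \<le> card (spt u) + card (spt v)"
proof -
  have "card (spt (u - v)) \<le> card (spt u \<union> spt v)"
    by (rule card_mono) (auto simp: spt_def)
  also have "\<dots> \<le> card (spt u) + card (spt v)"
    by (rule card_Un_le)
  finally show ?thesis .
qed

text \<open>Cauchy-Schwarz against the constant 1, with the sum restricted to the support. Applied
  to \<open>u - \<beta>\<close>, it trades the \<ell>1 bound of (H1) for the \<ell>2 error, at the
  price of a support size.\<close>

lemma l1_norm_le_sqrt_card_spt:
  fixes u :: "real ^ 'p"
  shows "l1_norm u \<le> sqrt (real (card (spt u))) * norm u"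
proof -
  have "l1_norm u = (\<Sum>i\<in>spt u. \<bar>1\<bar> * \<bar>u $ i\<bar>)"
    unfolding l1_norm_def by (rule sum.mono_neutral_cong_right) (auto simp: spt_def)
  also have "\<dots> \<le> L2_set (\<lambda>_. 1) (spt u) * L2_set (\<lambda>i. u $ i) (spt u)"
    by (rule L2_set_mult_ineq)
  also have "\<dots> \<le> sqrt (real (card (spt u))) * norm u"
    by (intro mult_mono)
      (auto simp: L2_set_def norm_vec_def intro!: sum_mono2 sum_nonneg)
  finally show ?thesis .
qed

lemma penalized_error_bound:
  fixes N \<delta> s b c\<^sub>1 c\<^sub>2 :: real
  assumes "N > 0" "c\<^sub>1 > 0" "c\<^sub>2 > 0" "s \<ge> 0" "b \<ge> 0"
    and ineq: "c\<^sub>2 * N * \<delta>\<^sup>2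
      \<le> 2 * (c\<^sub>1 * sqrt N * (sqrt (s + b) * \<delta>)) - 3 * c\<^sub>1\<^sup>2 / c\<^sub>2 * (s - b)"
  shows "\<delta> \<le> 3 * c\<^sub>1 / c\<^sub>2 * sqrt b / sqrt N"
proof -
  \<comment> \<open>Multiplying \<open>ineq\<close> by \<open>c\<^sub>2\<close> clears the
    denominator; in these variables the left side is a square and the stochastic term is
    \<open>2 * (x * y)\<close>.\<close>
  define x where "x = c\<^sub>2 * (sqrt N * \<delta>)"
  define y where "y = c\<^sub>1 * sqrt (s + b)"
  have x2: "x\<^sup>2 = c\<^sub>2 * (c\<^sub>2 * N * \<delta>\<^sup>2)"
    using assms by (simp add: x_def power_mult_distrib power2_eq_square)
  have y2: "y\<^sup>2 = c\<^sub>1\<^sup>2 * (s + b)"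
    using assms by (simp add: y_def power_mult_distrib)
  have "c\<^sub>2 * (c\<^sub>2 * N * \<delta>\<^sup>2)
      \<le> c\<^sub>2 * (2 * (c\<^sub>1 * sqrt N * (sqrt (s + b) * \<delta>)) - 3 * c\<^sub>1\<^sup>2 / c\<^sub>2 * (s - b))"
    using ineq \<open>c\<^sub>2 > 0\<close> by (intro mult_left_mono) auto
  also have "\<dots> = 2 * (x * y) - c\<^sub>2 * (3 * c\<^sub>1\<^sup>2 / c\<^sub>2) * (s - b)"
    unfolding x_def y_def right_diff_distrib by (simp only: mult_ac)
  also have "\<dots> = 2 * (x * y) - 3 * c\<^sub>1\<^sup>2 * (s - b)"
    using \<open>c\<^sub>2 > 0\<close> by simp
  finally have "x\<^sup>2 \<le> 2 * (x * y) - 3 * c\<^sub>1\<^sup>2 * (s - b)"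
    by (simp only: x2)
  \<comment> \<open>The weight makes \<open>3 * y\<^sup>2\<close> contain exactly
    \<open>3 * c\<^sub>1\<^sup>2 * s\<close>, which the penalty removes. What remains is 2/3 of
    \<open>x\<^sup>2\<close> against \<open>6 * c\<^sub>1\<^sup>2 * b\<close>, hence the factor 9
    below.\<close>
  moreover have "2 * (x * y) \<le> x\<^sup>2 / 3 + 3 * y\<^sup>2"
    using zero_le_power2[of "x - 3 * y"] by (simp add: power2_eq_square algebra_simps)
  ultimately have "x\<^sup>2 \<le> 9 * (c\<^sub>1\<^sup>2 * b)"
    unfolding y2 by (simp add: algebra_simps)
  also have "\<dots> = (3 * c\<^sub>1 * sqrt b)\<^sup>2"
    using assms by (simp add: power_mult_distrib)
  finally have "x \<le> 3 * c\<^sub>1 * sqrt b"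
    by (rule power2_le_imp_le) (use assms in auto)
  then have "x / (c\<^sub>2 * sqrt N) \<le> 3 * c\<^sub>1 * sqrt b / (c\<^sub>2 * sqrt N)"
    using assms by (intro divide_right_mono) auto
  then show ?thesis
    using assms by (simp add: x_def)
qed

theorem proposition2p1:
  fixes M :: "'w measure"
    and X :: "real ^ 'p ^ 'n"
    and \<beta> :: "real ^ 'p"
    and D :: "(real ^ 'p) set"
    and \<epsilon> :: "'w \<Rightarrow> real ^ 'n"
    and G :: "real ^ 'n \<Rightarrow> real"
    and \<phi> \<psi> :: "'n \<Rightarrow> real \<Rightarrow> real"
    and q c\<^sub>1 c\<^sub>2 c\<^sub>r \<kappa>\<^sub>r :: real
    and \<beta>hat :: "'w \<Rightarrow> real ^ 'p"
  defines "c\<^sub>r \<equiv> 3 * c\<^sub>1\<^sup>2 / c\<^sub>2"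
    and "\<kappa>\<^sub>r \<equiv> 3 * c\<^sub>1 / c\<^sub>2"
  assumes "prob_space M"
    and "\<forall>j. column j X \<noteq> 0"
    and "\<epsilon> \<in> borel_measurable M"
    and "0 < q" and "q < 1"
    and "c\<^sub>1 > 0" and "c\<^sub>2 > 0"
    and H1: "\<P>(\<omega> in M. \<forall>u\<in>D.
          \<bar>\<epsilon> \<omega> \<bullet> (apply_coords \<phi> (X *v u) - apply_coords \<phi> (X *v \<beta>))\<bar>
            \<le> c\<^sub>1 * sqrt (real CARD('n)) * l1_norm (u - \<beta>)) \<ge> 1 - 2 * q"
    and H2: "\<forall>u\<in>D. G (apply_coords \<psi> (X *v u) - apply_coords \<psi> (X *v \<beta>))
            \<ge> c\<^sub>2 * real CARD('n) * (norm (u - \<beta>))\<^sup>2"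
    and "\<beta>hat \<in> borel_measurable M"
    and "\<forall>\<omega>\<in>space M. \<beta>hat \<omega> \<in> D"
    and "\<forall>\<omega>\<in>space M.
          G (apply_coords \<psi> (X *v \<beta>hat \<omega>) - apply_coords \<psi> (X *v \<beta>))
            \<le> 2 * \<bar>\<epsilon> \<omega> \<bullet> (apply_coords \<phi> (X *v \<beta>hat \<omega>) - apply_coords \<phi> (X *v \<beta>))\<bar>
              - c\<^sub>r * (real (card (spt (\<beta>hat \<omega>))) - real (card (spt \<beta>)))"
  shows "\<P>(\<omega> in M. norm (\<beta>hat \<omega> - \<beta>)
          \<le> \<kappa>\<^sub>r * sqrt (real (card (spt \<beta>))) / sqrt (real CARD('n))) \<ge> 1 - 2 * q"
proof -
  interpret prob_space M by fact
  let ?N = "real CARD('n)"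
  let ?E = "{\<omega> \<in> space M. \<forall>u\<in>D.
      \<bar>\<epsilon> \<omega> \<bullet> (apply_coords \<phi> (X *v u) - apply_coords \<phi> (X *v \<beta>))\<bar>
        \<le> c\<^sub>1 * sqrt ?N * l1_norm (u - \<beta>)}"
  let ?F = "{\<omega> \<in> space M. norm (\<beta>hat \<omega> - \<beta>)
      \<le> \<kappa>\<^sub>r * sqrt (real (card (spt \<beta>))) / sqrt ?N}"
  \<comment> \<open>The inclusion is deterministic: the bound in \<open>?E\<close> is uniform over
    \<open>D\<close>, so it may be instantiated at the random point
    \<open>\<beta>hat \<omega>\<close>.\<close>
  have "?E \<subseteq> ?F"
  proof safe
    fix \<omega>
    assume \<omega>: "\<omega> \<in> space M" and E: "\<forall>u\<in>D.
      \<bar>\<epsilon> \<omega> \<bullet> (apply_coords \<phi> (X *v u) - apply_coords \<phi> (X *v \<beta>))\<bar>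
        \<le> c\<^sub>1 * sqrt ?N * l1_norm (u - \<beta>)"
    define u where "u = \<beta>hat \<omega>"
    let ?s = "real (card (spt u))" and ?b = "real (card (spt \<beta>))"
    have u: "u \<in> D"
      using \<omega> assms(13) by (simp add: u_def)
    have "l1_norm (u - \<beta>) \<le> sqrt (real (card (spt (u - \<beta>)))) * norm (u - \<beta>)"
      by (rule l1_norm_le_sqrt_card_spt)
    also have "\<dots> \<le> sqrt (?s + ?b) * norm (u - \<beta>)"
      using card_spt_diff_le[of u \<beta>] by (intro mult_right_mono) auto
    finally have l1: "c\<^sub>1 * sqrt ?N * l1_norm (u - \<beta>)
        \<le> c\<^sub>1 * sqrt ?N * (sqrt (?s + ?b) * norm (u - \<beta>))"
      using \<open>c\<^sub>1 > 0\<close> by (intro mult_left_mono) auto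
    \<comment> \<open>(H2) bounds the \<open>G\<close> term from below, the inequality satisfied by
      the estimator bounds it from above, and \<open>E\<close> with \<open>l1\<close> controls the
      stochastic term.\<close>
    have "c\<^sub>2 * ?N * (norm (u - \<beta>))\<^sup>2
        \<le> 2 * (c\<^sub>1 * sqrt ?N * (sqrt (?s + ?b) * norm (u - \<beta>))) - c\<^sub>r * (?s - ?b)"
      using bspec[OF H2 u] bspec[OF E u] l1 assms(14)[rule_format, OF \<omega>, folded u_def]
      by linarith
    then show "norm (\<beta>hat \<omega> - \<beta>) \<le> \<kappa>\<^sub>r * sqrt ?b / sqrt ?N"
      unfolding u_def[symmetric] c\<^sub>r_def \<kappa>\<^sub>r_def
      using \<open>c\<^sub>1 > 0\<close> \<open>c\<^sub>2 > 0\<close> by (intro penalized_error_bound[where s = ?s]) auto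
  qed
  \<comment> \<open>Monotonicity of the measure requires the larger set to be measurable.\<close>
  moreover have "?F \<in> sets M"
    using \<open>\<beta>hat \<in> borel_measurable M\<close> by measurable
  \<comment> \<open>\<open>?E\<close> need not be measurable, but then its measure is \<open>0\<close> by convention.\<close>
  ultimately have "prob ?E \<le> prob ?F"
    by (cases "?E \<in> sets M") (auto simp: measure_notin_sets intro: finite_measure_mono)
  with H1 show ?thesis by simp
qed

end
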